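(* For every positive integer $n$ and every non-negative integer $i$, the polynomial $$f(x)=x^{\frac{3^n-1}{2}+3^i}+2x^{\frac{3^n-1}{2}+3}+2x^{\frac{3^n-1}{2}+2}+2x^{\frac{3^n-1}{2}+1}+x^{3^i}+x^3+x^2+x$$ is a permutation polynomial of $\mathbb{F}_{3^n}$.
   Context: A polynomial is a permutation polynomial (PP) of a finite field if it induces a bijection of that field to itself. *)

theory Defs
  imports "HOL-Computational_Algebra.Polynomial" "HOL-Library.Cardinality"
begin

definition permutation_poly :: "'a::{field,finite} poly \<Rightarrow> bool" where
  "permutation_poly p \<longleftrightarrow> bij (poly p)"

end

theory Submission imports Defs "HOL-Computational_Algebra.Primes" begin

text \<open>
  Write \<open>\<chi>(x) = x^((q - 1) / 2)\<close> with \<open>q = 3^n\<close>. The polynomial vanishes at \<open>0\<close>, equals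
  \<open>- x^(3^i)\<close> where \<open>\<chi>(x) = 1\<close>, and equals \<open>- x (x - 1)^2\<close> where \<open>\<chi>(x) = - 1\<close>. Hence
  \<open>\<chi>(f(x)) = \<chi>(- 1) \<chi>(x)\<close>, so collisions can only occur within one class of \<open>\<chi>\<close>. The first
  branch is a power of Frobenius. On the second one,
  \<open>x (x - 1)^2 = y (y - 1)^2\<close> with \<open>d = x - y \<noteq> 0\<close> gives \<open>y = (d - 1)^2\<close>, contradicting
  \<open>\<chi>(y) = - 1\<close>.
\<close>

text \<open>Translation by 1 permutes the ring, so it preserves the sum of all elements; cancelling
  that sum leaves \<open>CARD('a)\<close> ones adding up to 0.\<close>

lemma of_nat_CARD_eq_0: "of_nat CARD('a) = (0 :: 'a::{ring_1,finite})"
proof -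
  have "(\<Sum>x\<in>UNIV. x + 1 :: 'a) = (\<Sum>x\<in>UNIV. x)"
    by (rule sum.reindex_bij_witness[of _ "\<lambda>x. x - 1" "\<lambda>x. x + 1"]) auto
  then show ?thesis
    by (simp add: sum.distrib)
qed

text \<open>Multiplication by \<open>x\<close> permutes the nonzero elements, and their product can
  be cancelled because it is nonzero.\<close>

lemma field_power_CARD_minus_1:
  fixes x :: "'a::{field,finite}"
  assumes "x \<noteq> 0"
  shows "x ^ (CARD('a) - 1) = 1"
proof -
  let ?U = "UNIV - {0 :: 'a}"
  have "(\<Prod>y\<in>?U. x * y) = \<Prod>?U"
    by (rule prod.reindex_bij_witness[of _ "\<lambda>y. y / x" "\<lambda>y. x * y"]) (use assms in auto)
  then have "x ^ card ?U * \<Prod>?U = \<Prod>?U"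
    by (simp add: prod.distrib)
  moreover have "\<Prod>?U \<noteq> 0"
    by simp
  ultimately show ?thesis
    by (simp add: card_Diff_singleton)
qed

context
  assumes char3: "(3 :: 'a::field) = 0"
begin

lemma char3_two: "(2 :: 'a) = - 1"
proof -
  have "(2 :: 'a) = 3 - 1" by simp
  then show ?thesis using char3 by simp
qed

lemma char3_CHAR: "CHAR('a) = 3"
proof -
  have "CHAR('a) dvd 3"
    using char3 of_nat_eq_0_iff_char_dvd[where 'a = 'a, of 3] by simp
  then show ?thesis
    using prime_nat_iff[of 3] CHAR_not_1[where 'a = 'a] by auto
qed

lemma char3_frobenius_diff: "(x - y) ^ 3 ^ i = x ^ 3 ^ i - (y :: 'a) ^ 3 ^ i"
  using freshmans_dream'[where 'a = 'a, of "3 ^ i" i "x - y" y]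
  by (simp add: char3_CHAR)

lemma char3_frobenius_inj:
  assumes "x ^ 3 ^ i = (y :: 'a) ^ 3 ^ i"
  shows "x = y"
proof -
  have "(x - y) ^ 3 ^ i = 0"
    using assms by (simp add: char3_frobenius_diff)
  then show ?thesis by simp
qed

lemma char3_cubic_eq: "x ^ 3 + x ^ 2 + x = x * (x - 1 :: 'a) ^ 2"
proof -
  have "x ^ 3 + x ^ 2 + x - x * (x - 1) ^ 2 = 3 * x ^ 2"
    by (simp add: power2_eq_square power3_eq_cube algebra_simps)
  then show ?thesis
    using char3 by simp
qed

lemma char3_cubic_collision:
  assumes "x ^ 3 + x ^ 2 + x = y ^ 3 + y ^ 2 + (y :: 'a)" and "x \<noteq> y"
  shows "y = (x - y - 1) ^ 2"
proof -
  \<comment> \<open>The difference of the two cubics is divisible by \<open>x - y\<close>; modulo 3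
    the cofactor is \<open>(x - y - 1) ^ 2 - y\<close>. The multiple of 3 makes this an identity in
    every characteristic.\<close>
  have "(x - y) * ((x - y - 1) ^ 2 - y) =
      (x ^ 3 + x ^ 2 + x - (y ^ 3 + y ^ 2 + y)) - 3 * (x - y) * (x * y + x)"
    by (simp add: power2_eq_square power3_eq_cube algebra_simps)
  then show ?thesis
    using assms char3 by simp
qed

end

theorem theorem1p3:
  fixes n i :: nat and f :: "'a::{field,finite} poly"
  assumes "n > 0"
    and "CARD('a) = 3 ^ n"
  defines "f \<equiv> monom 1 ((3 ^ n - 1) div 2 + 3 ^ i)
      + monom 2 ((3 ^ n - 1) div 2 + 3)
      + monom 2 ((3 ^ n - 1) div 2 + 2)
      + monom 2 ((3 ^ n - 1) div 2 + 1)
      + monom 1 (3 ^ i) + monom 1 3 + monom 1 2 + monom 1 1"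
  shows "permutation_poly f"
proof -
  define m where "m = (3 ^ n - 1 :: nat) div 2"
  define \<chi> where "\<chi> x = x ^ m" for x :: 'a
  have "(3 :: 'a) ^ n = 0"
    using of_nat_CARD_eq_0[where 'a = 'a] assms(2) by simp
  then have char3: "(3 :: 'a) = 0"
    by simp
  note two = char3_two[OF char3]
  have m: "2 * m = 3 ^ n - 1"
    by (simp add: m_def)
  \<comment> \<open>Positivity of \<open>m\<close> matters: for \<open>m = 0\<close> the value
    \<open>\<chi> 0\<close> would be \<open>0 ^ 0 = 1\<close>.\<close>
  have "(3::nat) ^ 1 \<le> 3 ^ n"
    using assms(1) by (intro power_increasing) auto
  then have "m > 0"
    using m by simp
  then have chi_0 [simp]: "\<chi> x = 0 \<longleftrightarrow> x = 0" for x
    by (simp add: \<chi>_def)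
  have chi_mult: "\<chi> (x * y) = \<chi> x * \<chi> y" for x y
    by (simp add: \<chi>_def power_mult_distrib)
  have chi_power: "\<chi> (x ^ k) = \<chi> x ^ k" for x k
    by (simp add: \<chi>_def power_mult [symmetric] mult.commute)
  have chi_sq: "\<chi> x ^ 2 = 1" if "x \<noteq> 0" for x
    using field_power_CARD_minus_1[OF that] assms(2) m
    by (simp add: \<chi>_def power_mult [symmetric] mult.commute)
  have chi_cases: "\<chi> x = 1 \<or> \<chi> x = - 1" if "x \<noteq> 0" for x
    using chi_sq[OF that] by (simp add: power2_eq_1_iff)
  have one_neq: "(1 :: 'a) \<noteq> - 1"
    using two by (metis one_neq_zero add.right_inverse numeral_One one_add_one neg_equal_0_iff_equal)
  \<comment> \<open>Reading the coefficients 2 as -1 lets the terms with \<open>m\<close> in the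
    exponent be collected into one multiple of \<open>\<chi> x\<close>.\<close>
  have f_eq: "poly f x = \<chi> x * (x ^ 3 ^ i - (x ^ 3 + x ^ 2 + x)) + x ^ 3 ^ i + (x ^ 3 + x ^ 2 + x)" for x
    unfolding f_def m_def [symmetric]
    by (simp add: \<chi>_def poly_monom power_add two power2_eq_square algebra_simps)
  have f_1: "poly f x = - (x ^ 3 ^ i)" if "\<chi> x = 1" for x
  proof -
    have "poly f x = 2 * x ^ 3 ^ i" by (simp add: f_eq that)
    then show ?thesis by (simp add: two)
  qed
  have f_m1: "poly f x = - (x ^ 3 + x ^ 2 + x)" if "\<chi> x = - 1" for x
  proof -
    have "poly f x = 2 * (x ^ 3 + x ^ 2 + x)" by (simp add: f_eq that)
    then show ?thesis by (simp only: two mult_minus1)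
  qed
  have chi_f: "\<chi> (poly f x) = \<chi> (- 1) * \<chi> x" for x
  proof (cases "x = 0")
    case True
    then show ?thesis using chi_0[of 0] by (simp add: f_eq power_0_left)
  next
    case False
    then consider "\<chi> x = 1" | "\<chi> x = - 1"
      using chi_cases by blast
    then show ?thesis
    proof cases
      case 1
      then show ?thesis
        using chi_mult[of "- 1" "x ^ 3 ^ i"] by (simp add: f_1 chi_power)
    next
      case 2
      \<comment> \<open>Since \<open>\<chi> 1 = 1\<close>, the factor \<open>x - 1\<close> is
        nonzero, so its square contributes 1 to the value of \<open>\<chi>\<close>.\<close>
      then have "x \<noteq> 1"
        using one_neq by (auto simp: \<chi>_def)
      then show ?thesis
        using chi_mult[of "- 1" "x * (x - 1) ^ 2"] 2 chi_sq[of "x - 1"]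
        by (simp add: f_m1 char3_cubic_eq[OF char3] chi_mult chi_power)
    qed
  qed
  have "inj (poly f)"
  proof (rule injI)
    fix x y assume eq: "poly f x = poly f y"
    \<comment> \<open>The common factor \<open>\<chi> (- 1)\<close> cancels, being nonzero by
      \<open>chi_0\<close>.\<close>
    then have chi_eq: "\<chi> x = \<chi> y"
      using chi_f[of x] chi_f[of y] by simp
    show "x = y"
    proof (cases "y = 0")
      case True
      then show ?thesis using chi_eq chi_0 by metis
    next
      case False
      then consider "\<chi> y = 1" | "\<chi> y = - 1"
        using chi_cases by blast
      then show ?thesis
      proof cases
        case 1
        then have "x ^ 3 ^ i = y ^ 3 ^ i"
          using eq chi_eq by (simp add: f_1)
        then show ?thesis
          by (rule char3_frobenius_inj[OF char3])
      next
        case 2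
        show ?thesis
        proof (rule ccontr)
          assume "x \<noteq> y"
          moreover have "x ^ 3 + x ^ 2 + x = y ^ 3 + y ^ 2 + y"
            using eq chi_eq 2 f_m1[of x] f_m1[of y] by (simp only: neg_equal_iff_equal)
          ultimately have y: "y = (x - y - 1) ^ 2"
            by (intro char3_cubic_collision[OF char3])
          \<comment> \<open>\<open>chi_sq\<close> requires a nonzero base; a zero base would force
            \<open>y = 0\<close>.\<close>
          then have "x - y - 1 \<noteq> 0"
            using False by (metis zero_power2)
          then have "\<chi> y = 1"
            using chi_power chi_sq y by metis
          then show False
            using 2 one_neq by simp
        qed
      qed
    qed
  qed
  then show ?thesis
    by (simp add: permutation_poly_def bij_def finite_UNIV_inj_surj)
qed

end
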